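(* Suppose $R\sim\mathcal{M}(F)$ with a matrix $F\in\mathbb{R}^{3\times3}$ having proper singular value decomposition $F=USV^T$. Then the max mean and the minimum mean square error mean of $R$ are identical and are given by $$\mathrm{M}_{\max}[R]=\mathrm{M}_{\mathrm{mse}}[R]=UV^T\in\mathsf{SO(3)}.$$
   Context: $\mathsf{SO(3)}=\{R\in\mathbb{R}^{3\times3}\mid R^TR=I_{3\times3},\det R=1\}$ carries the Haar measure $dR$ normalized by $\int_{\mathsf{SO(3)}}dR=1$. For $F\in\mathbb{R}^{3\times3}$, $R\sim\mathcal{M}(F)$ (matrix Fisher distribution) means that $R\in\mathsf{SO(3)}$ has density $p(R)=\frac{1}{c(F)}\exp(\mathrm{tr}[F^TR])$ with respect to $dR$, where $c(F)=\int_{\mathsf{SO(3)}}\exp(\mathrm{tr}[F^TR])\,dR$. For a probability density $p$ on $\mathsf{SO(3)}$, the max mean is $\mathrm{M}_{\max}[R]=\arg\max_{R\in\mathsf{SO(3)}}\{p(R)\}$, and the minimum mean square error (MMSE) mean is $\mathrm{M}_{\mathrm{mse}}[R]=\arg\min_{R\in\mathsf{SO(3)}}\left\{\int_{\mathsf{SO(3)}}\|R-\tilde R\|_F^2\,p(\tilde R)\,d\tilde R\right\}$, where $\|A\|_F=\sqrt{\mathrm{tr}[A^TA]}$. Proper singular value decomposition: let $F=U'S'(V')^T$ be a singular value decomposition with $U',V'$ orthogonal and $S'=\mathrm{diag}[s_1',s_2',s_3']$, $s_1'\ge s_2'\ge s_3'\ge0$. The proper singular value decomposition is $F=USV^T$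 with $U=U'\mathrm{diag}[1,1,\det U']\in\mathsf{SO(3)}$, $V=V'\mathrm{diag}[1,1,\det V']\in\mathsf{SO(3)}$, $S=\mathrm{diag}[s_1',s_2',\det[U'V']s_3']$.
   Formalization: The means are taken as sets of all optimizers; the two sets are proved equal and to contain UV^T for every F, and to be exactly {UV^T} when s_2+s_3>0 (entries of S), since otherwise (e.g. F=0) the optimizer is not unique. *)

theory Defs
  imports "HOL-Probability.Probability"
begin

definition SO3 :: "(real^3^3) set" where
  "SO3 = {R. rotation_matrix R}"

definition diag3 :: "real \<Rightarrow> real \<Rightarrow> real \<Rightarrow> real^3^3" where
  "diag3 a b c = (\<chi> i j. if i = j then vector [a, b, c] $ i else 0)"

definition frobenius_norm :: "real^3^3 \<Rightarrow> real" where
  "frobenius_norm A = sqrt (trace (transpose A ** A))"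

(* As SO(3) is compact, the conditions below determine the measure uniquely,
   and right invariance follows from left invariance. *)
definition haar_SO3 :: "(real^3^3) measure \<Rightarrow> bool" where
  "haar_SO3 \<mu> \<longleftrightarrow>
     sets \<mu> = sets (restrict_space borel SO3) \<and>
     prob_space \<mu> \<and>
     (\<forall>Q\<in>SO3. distr \<mu> \<mu> (\<lambda>R. Q ** R) = \<mu>)"

definition fisher_const :: "(real^3^3) measure \<Rightarrow> real^3^3 \<Rightarrow> real" where
  "fisher_const \<mu> F = (LINT R|\<mu>. exp (trace (transpose F ** R)))"

definition fisher_density :: "(real^3^3) measure \<Rightarrow> real^3^3 \<Rightarrow> real^3^3 \<Rightarrow> real" where
  "fisher_density \<mu> F R = 1 / fisher_const \<mu> F * exp (trace (transpose F ** R))"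

definition matrix_fisher ::
  "'w measure \<Rightarrow> (real^3^3) measure \<Rightarrow> real^3^3 \<Rightarrow> ('w \<Rightarrow> real^3^3) \<Rightarrow> bool" where
  "matrix_fisher \<Omega> \<mu> F R \<longleftrightarrow>
     prob_space \<Omega> \<and> distributed \<Omega> \<mu> R (\<lambda>Q. ennreal (fisher_density \<mu> F Q))"

(* The two means of a density p are the full sets of optimizers,
   since an optimizer need not be unique (e.g. for constant p). *)
definition max_mean :: "(real^3^3 \<Rightarrow> real) \<Rightarrow> (real^3^3) set" where
  "max_mean p = {R. is_arg_max p (\<lambda>R. R \<in> SO3) R}"

definition mmse_mean :: "(real^3^3) measure \<Rightarrow> (real^3^3 \<Rightarrow> real) \<Rightarrow> (real^3^3) set" where
  "mmse_mean \<mu> p =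
     {R. is_arg_min (\<lambda>R. LINT Q|\<mu>. (frobenius_norm (R - Q))\<^sup>2 * p Q) (\<lambda>R. R \<in> SO3) R}"

definition is_svd :: "real^3^3 \<Rightarrow> real^3^3 \<Rightarrow> real \<Rightarrow> real \<Rightarrow> real \<Rightarrow> real^3^3 \<Rightarrow> bool" where
  "is_svd F U s1 s2 s3 V \<longleftrightarrow>
     orthogonal_matrix U \<and> orthogonal_matrix V \<and> s1 \<ge> s2 \<and> s2 \<ge> s3 \<and> s3 \<ge> 0 \<and>
     F = U ** diag3 s1 s2 s3 ** transpose V"

definition is_proper_svd :: "real^3^3 \<Rightarrow> real^3^3 \<Rightarrow> real^3^3 \<Rightarrow> real^3^3 \<Rightarrow> bool" where
  "is_proper_svd F U S V \<longleftrightarrow>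
     (\<exists>U' s1 s2 s3 V'. is_svd F U' s1 s2 s3 V' \<and>
        U = U' ** diag3 1 1 (det U') \<and>
        V = V' ** diag3 1 1 (det V') \<and>
        S = diag3 s1 s2 (det (U' ** V') * s3))"

end

theory Submission
  imports Defs
begin

text \<open>
With the inner product \<open>A \<bullet> B = trace (A\<^sup>T B)\<close>, the max mean consists of the maximizers over the
rotations of \<open>R \<mapsto> F \<bullet> R\<close>. On rotations \<open>\<parallel>R - Q\<parallel>\<^sup>2 = 6 - 2 (R \<bullet> Q)\<close>, so the minimum mean square
error mean consists of the maximizers of \<open>R \<mapsto> M \<bullet> R\<close>, where \<open>M\<close> is the integral of \<open>Q exp (F \<bullet> Q)\<close>.
The Haar measure is invariant from both sides, so the substitution \<open>W = U\<^sup>T R V\<close> replaces \<open>F\<close> by the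
diagonal matrix \<open>S\<close> with entries \<open>s\<^sub>i\<close>, and \<open>M\<close> by the corresponding integral for \<open>S\<close>. The latter is again
diagonal, because conjugation by a half turn about a coordinate axis preserves \<open>S \<bullet> Q\<close> and changes
the sign of off-diagonal entries; call its entries \<open>d\<^sub>i\<close>.

Both means therefore maximize a diagonal linear form, and the maximizers of such a form depend on very
little. The identity
\<open>2 (S \<bullet> 1 - S \<bullet> W) = \<Sum>\<^sub>k (s\<^sub>i + s\<^sub>j) (1 + W\<^sub>k\<^sub>k - W\<^sub>i\<^sub>i - W\<^sub>j\<^sub>j)\<close>, where \<open>{i, j, k} = {1, 2, 3}\<close>,
has nonnegative factors: the first by the ordering of proper singular values, the second because a
rotation has trace at least \<open>-1\<close> (\<open>SO3_trace_ge\<close>). Hence the identity matrix is a maximizer, and the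
set of all maximizers is determined by which of the sums \<open>s\<^sub>i + s\<^sub>j\<close> vanish (\<open>diag_inner_le\<close>).

It remains to see that \<open>d\<^sub>i + d\<^sub>j\<close> is nonnegative and vanishes exactly when \<open>s\<^sub>i + s\<^sub>j\<close> does
(\<open>moment_pair\<close>). For a quarter turn \<open>A\<close> in the plane of the axes \<open>i\<close> and \<open>j\<close>, the map \<open>Q \<mapsto> A Q A\<close> negates
\<open>a = Q\<^sub>i\<^sub>i + Q\<^sub>j\<^sub>j\<close> and keeps \<open>Q\<^sub>i\<^sub>i - Q\<^sub>j\<^sub>j\<close> and \<open>Q\<^sub>k\<^sub>k\<close>. Averaging the integral of \<open>a exp (S \<bullet> Q)\<close> over
this symmetry gives the integral of \<open>a sinh (p a)\<close> times a positive function, with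
\<open>p = (s\<^sub>i + s\<^sub>j) / 2\<close>; this is nonnegative, and positive for \<open>p > 0\<close> as \<open>a\<close> is not almost everywhere zero.
\<close>

section \<open>The inner product of matrices and the geometry of rotations\<close>

lemma inner_matrix: "A \<bullet> B = (\<Sum>i\<in>UNIV. \<Sum>j\<in>UNIV. A $ i $ j * B $ i $ j)" for A B :: "real^'n^'m"
  by (simp add: inner_vec_def)

lemma trace_eq_inner: "trace (transpose A ** B) = A \<bullet> B" for A B :: "real^'n^'n"
  unfolding inner_matrix by (subst sum.swap) (simp add: trace_def matrix_matrix_mult_def transpose_def)

lemma inner_matrix_mult_left: "(A ** X) \<bullet> Y = X \<bullet> (transpose A ** Y)" for A X Y :: "real^'n^'n"
  by (simp flip: trace_eq_inner add: matrix_transpose_mul matrix_mul_assoc)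

lemma inner_transpose: "transpose X \<bullet> transpose Y = X \<bullet> Y" for X Y :: "real^'n^'n"
  unfolding inner_matrix by (subst sum.swap) (simp add: transpose_def)

lemma inner_matrix_mult_right: "(X ** A) \<bullet> Y = X \<bullet> (Y ** transpose A)" for A X Y :: "real^'n^'n"
proof -
  have "(X ** A) \<bullet> Y = (transpose A ** transpose X) \<bullet> transpose Y"
    by (simp flip: inner_transpose[of "X ** A"] add: matrix_transpose_mul)
  also have "\<dots> = transpose X \<bullet> transpose (Y ** transpose A)"
    by (simp add: inner_matrix_mult_left matrix_transpose_mul)
  finally show ?thesis
    by (simp only: inner_transpose)
qed

lemma SO3_iff: "W \<in> SO3 \<longleftrightarrow> transpose W ** W = mat 1 \<and> det W = 1"
  by (simp add: SO3_def rotation_matrix_def orthogonal_matrix)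

lemma SO3_transpose_mult: "W \<in> SO3 \<Longrightarrow> transpose W ** W = mat 1"
  by (simp add: SO3_iff)

lemma SO3_mult_transpose: "W \<in> SO3 \<Longrightarrow> W ** transpose W = mat 1"
  by (simp add: SO3_iff matrix_left_right_inverse)

lemma SO3_mult: "A \<in> SO3 \<Longrightarrow> B \<in> SO3 \<Longrightarrow> A ** B \<in> SO3"
  by (simp add: SO3_def rotation_matrix_def orthogonal_matrix_mul det_mul)

lemma SO3_transpose: "A \<in> SO3 \<Longrightarrow> transpose A \<in> SO3"
  by (simp add: SO3_def rotation_matrix_def)

lemma SO3_mat_1: "mat 1 \<in> SO3"
  by (simp add: SO3_iff)

lemma SO3_inner_self: "W \<in> SO3 \<Longrightarrow> W \<bullet> W = 3"
  by (simp flip: trace_eq_inner add: SO3_transpose_mult trace_I)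

text \<open>The inverse of a rotation is both its transpose and its adjugate; the cross product gives this columnwise.\<close>

lemma SO3_diagonal_cofactors:
  assumes "W \<in> SO3"
  shows "W$1$1 = W$2$2 * W$3$3 - W$2$3 * W$3$2"
    and "W$2$2 = W$3$3 * W$1$1 - W$3$1 * W$1$3"
    and "W$3$3 = W$1$1 * W$2$2 - W$1$2 * W$2$1"
proof -
  have *: "cross3 (W *v x) (W *v y) = W *v cross3 x y" for x y
    using assms cross_rotation_matrix by (simp add: SO3_def)
  show "W$1$1 = W$2$2 * W$3$3 - W$2$3 * W$3$2"
    using *[of "axis 2 1" "axis 3 1"]
    by (simp add: vec_eq_iff forall_3 cross3_def matrix_vector_mult_def sum_3 axis_def vector_3 algebra_simps)
  show "W$2$2 = W$3$3 * W$1$1 - W$3$1 * W$1$3"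
    using *[of "axis 3 1" "axis 1 1"]
    by (simp add: vec_eq_iff forall_3 cross3_def matrix_vector_mult_def sum_3 axis_def vector_3 algebra_simps)
  show "W$3$3 = W$1$1 * W$2$2 - W$1$2 * W$2$1"
    using *[of "axis 1 1" "axis 2 1"]
    by (simp add: vec_eq_iff forall_3 cross3_def matrix_vector_mult_def sum_3 axis_def vector_3 algebra_simps)
qed

lemma SO3_trace_le_3:
  assumes "W \<in> SO3"
  shows "trace W \<le> 3" and "trace W = 3 \<Longrightarrow> W = mat 1"
proof -
  have tr: "mat 1 \<bullet> W = trace W"
    by (simp flip: trace_eq_inner)
  have "(W - mat 1) \<bullet> (W - mat 1) = 6 - 2 * trace W"
    using SO3_inner_self[OF assms] SO3_inner_self[OF SO3_mat_1]
    by (simp add: inner_diff_left inner_diff_right tr inner_commute[of W "mat 1"])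
  then show "trace W \<le> 3" "trace W = 3 \<Longrightarrow> W = mat 1"
    using inner_ge_zero[of "W - mat 1"] by auto
qed

text \<open>In terms of the rotation angle \<open>\<theta>\<close> the trace \<open>t\<close> is \<open>1 + 2 cos \<theta>\<close>. The proof needs no rotation axis: both
sides of \<open>(1 + t) (3 - t) = \<Sum>\<^sub>i\<^sub>j (W\<^sub>i\<^sub>j - W\<^sub>j\<^sub>i)\<^sup>2 / 2\<close> equal \<open>4 (sin \<theta>)\<^sup>2\<close>, and the identity follows from the
cofactor formulas and \<open>W \<bullet> W = 3\<close>.\<close>

lemma SO3_trace_ge:
  assumes "W \<in> SO3"
  shows "- 1 \<le> trace W"
proof -
  define t where "t = trace W"
  have t: "t = W$1$1 + W$2$2 + W$3$3"
    by (simp add: t_def trace_def sum_3)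
  define n where "n = W$1$1^2 + W$1$2^2 + W$1$3^2 + W$2$1^2 + W$2$2^2 + W$2$3^2 + W$3$1^2 + W$3$2^2 + W$3$3^2"
  define c where "c = (W$2$2 * W$3$3 - W$2$3 * W$3$2) + (W$3$3 * W$1$1 - W$3$1 * W$1$3)
    + (W$1$1 * W$2$2 - W$1$2 * W$2$1)"
  have "n = 3"
    using SO3_inner_self[OF assms] by (simp add: n_def inner_matrix sum_3 power2_eq_square)
  moreover have "c = t"
    unfolding c_def t by (simp flip: SO3_diagonal_cofactors[OF assms])
  moreover have "(1 + t) * (3 - t) + (n - 3) + 2 * (c - t)
      = (W$1$2 - W$2$1)^2 + (W$1$3 - W$3$1)^2 + (W$2$3 - W$3$2)^2"
    unfolding n_def c_def t by (simp add: algebra_simps power2_eq_square)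
  ultimately have "(1 + t) * (3 - t) = (W$1$2 - W$2$1)^2 + (W$1$3 - W$3$1)^2 + (W$2$3 - W$3$2)^2"
    by simp
  then have "0 \<le> (1 + t) * (3 - t)"
    by simp
  moreover have "t \<le> 3"
    using SO3_trace_le_3(1)[OF assms] by (simp add: t_def)
  ultimately show ?thesis
    unfolding t_def[symmetric] by (cases "t = 3") (auto simp: zero_le_mult_iff)
qed

definition half_turn :: "3 \<Rightarrow> real^3^3" where
  "half_turn k = (\<chi> r c. if r = c then (if r = k then 1 else - 1) else 0)"

text \<open>The turn by a right angle in the oriented plane of the axes \<open>i\<close> and \<open>j\<close>; a rotation only for \<open>i \<noteq> j\<close>.\<close>

definition quarter_turn :: "3 \<Rightarrow> 3 \<Rightarrow> real^3^3" where
  "quarter_turn i j = (\<chi> r c. if r = i \<and> c = j then - 1 else if r = j \<and> c = i then 1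
     else if r = c \<and> r \<noteq> i \<and> r \<noteq> j then 1 else 0)"

lemma half_turn_SO3: "half_turn k \<in> SO3"
  using exhaust_3[of k]
  by (auto simp: SO3_iff half_turn_def det_3 vec_eq_iff forall_3 matrix_matrix_mult_def sum_3 transpose_def mat_def)

lemma quarter_turn_SO3: "i \<noteq> j \<Longrightarrow> quarter_turn i j \<in> SO3"
  using exhaust_3[of i] exhaust_3[of j]
  by (elim disjE) (simp_all add: SO3_iff quarter_turn_def det_3 vec_eq_iff forall_3 matrix_matrix_mult_def sum_3 transpose_def mat_def)

lemma half_turn_mult: "(half_turn k ** Q) $ r $ c = (if r = k then 1 else - 1) * Q $ r $ c"
  using exhaust_3[of k] exhaust_3[of r]
  by (auto simp: half_turn_def matrix_matrix_mult_def sum_3)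

lemma mult_half_turn: "(Q ** half_turn k) $ r $ c = (if c = k then 1 else - 1) * Q $ r $ c"
  using exhaust_3[of k] exhaust_3[of c]
  by (auto simp: half_turn_def matrix_matrix_mult_def sum_3)

lemma quarter_turn_mult_row: "i \<noteq> j \<Longrightarrow> (quarter_turn i j ** Q) $ i $ c = - Q $ j $ c"
  using exhaust_3[of i] exhaust_3[of j]
  by (auto simp: quarter_turn_def matrix_matrix_mult_def sum_3)

lemma quarter_turn_conj_diagonal:
  assumes "i \<noteq> j"
  shows "(quarter_turn i j ** Q ** quarter_turn i j) $ i $ i = - Q $ j $ j"
    and "(quarter_turn i j ** Q ** quarter_turn i j) $ j $ j = - Q $ i $ i"
    and "k \<noteq> i \<Longrightarrow> k \<noteq> j \<Longrightarrow> (quarter_turn i j ** Q ** quarter_turn i j) $ k $ k = Q $ k $ k"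
  using exhaust_3[of i] exhaust_3[of j] exhaust_3[of k] assms
  by (auto simp: quarter_turn_def matrix_matrix_mult_def sum_3)

text \<open>Up to a shift by 1, the difference of the two sides is the trace of \<open>W\<close> composed with a half turn.
In quaternion coordinates \<open>q\<close> of \<open>W\<close> it is \<open>4 q\<^sub>k\<^sup>2\<close>.\<close>

lemma SO3_diagonal_slack:
  assumes "W \<in> SO3"
  shows "W$2$2 + W$3$3 \<le> 1 + W$1$1" "W$1$1 + W$3$3 \<le> 1 + W$2$2" "W$1$1 + W$2$2 \<le> 1 + W$3$3"
  using SO3_trace_ge[OF SO3_mult[OF half_turn_SO3 assms, of 1]]
        SO3_trace_ge[OF SO3_mult[OF half_turn_SO3 assms, of 2]]
        SO3_trace_ge[OF SO3_mult[OF half_turn_SO3 assms, of 3]]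
  by (simp_all add: trace_def sum_3 half_turn_mult)

section \<open>Maximizing a diagonal linear form over the rotations\<close>

definition diag :: "real^3 \<Rightarrow> real^3^3" where
  "diag s = (\<chi> i j. if i = j then s $ i else 0)"

lemma diag3_eq_diag: "diag3 a b c = diag (vector [a, b, c])"
  by (simp add: diag3_def diag_def)

lemma diag_inner: "diag s \<bullet> Q = (\<Sum>i\<in>UNIV. s $ i * Q $ i $ i)"
  by (simp add: inner_matrix diag_def sum_3)

definition pairs_nonneg :: "real^3 \<Rightarrow> bool" where
  "pairs_nonneg s \<longleftrightarrow> (\<forall>i j. i \<noteq> j \<longrightarrow> 0 \<le> s $ i + s $ j)"

lemma diag_inner_slack:
  "2 * (diag s \<bullet> mat 1 - diag s \<bullet> W) =
     (s$2 + s$3) * (1 + W$1$1 - (W$2$2 + W$3$3)) + (s$1 + s$3) * (1 + W$2$2 - (W$1$1 + W$3$3))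
       + (s$1 + s$2) * (1 + W$3$3 - (W$1$1 + W$2$2))"
  by (simp add: diag_inner sum_3 mat_def algebra_simps)

text \<open>The second part is the point of this section: the maximizers depend on \<open>s\<close> only through the vanishing
of its three pair sums, so two diagonal forms with the same pattern have the same maximizers.\<close>

lemma diag_inner_le:
  assumes "pairs_nonneg s" "W \<in> SO3"
  shows "diag s \<bullet> W \<le> diag s \<bullet> mat 1"
    and "diag s \<bullet> W = diag s \<bullet> mat 1 \<longleftrightarrow>
      (s$2 + s$3 = 0 \<or> 1 + W$1$1 = W$2$2 + W$3$3) \<and> (s$1 + s$3 = 0 \<or> 1 + W$2$2 = W$1$1 + W$3$3)
       \<and> (s$1 + s$2 = 0 \<or> 1 + W$3$3 = W$1$1 + W$2$2)"
proof -
  define x where "x = (s$2 + s$3) * (1 + W$1$1 - (W$2$2 + W$3$3))"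
  define y where "y = (s$1 + s$3) * (1 + W$2$2 - (W$1$1 + W$3$3))"
  define z where "z = (s$1 + s$2) * (1 + W$3$3 - (W$1$1 + W$2$2))"
  have nn: "0 \<le> x" "0 \<le> y" "0 \<le> z"
    using assms(1) SO3_diagonal_slack[OF assms(2)] by (auto simp: x_def y_def z_def pairs_nonneg_def)
  have eq: "2 * (diag s \<bullet> mat 1 - diag s \<bullet> W) = x + y + z"
    unfolding x_def y_def z_def by (rule diag_inner_slack)
  show "diag s \<bullet> W \<le> diag s \<bullet> mat 1"
    using nn eq by (smt (verit))
  have "diag s \<bullet> W = diag s \<bullet> mat 1 \<longleftrightarrow> x = 0 \<and> y = 0 \<and> z = 0"
    using nn eq by (smt (verit))
  then show "diag s \<bullet> W = diag s \<bullet> mat 1 \<longleftrightarrow>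
      (s$2 + s$3 = 0 \<or> 1 + W$1$1 = W$2$2 + W$3$3) \<and> (s$1 + s$3 = 0 \<or> 1 + W$2$2 = W$1$1 + W$3$3)
       \<and> (s$1 + s$2 = 0 \<or> 1 + W$3$3 = W$1$1 + W$2$2)"
    unfolding x_def y_def z_def by auto
qed

lemma diag_inner_max_unique:
  assumes "\<And>i j. i \<noteq> j \<Longrightarrow> 0 < s $ i + s $ j" "W \<in> SO3" "diag s \<bullet> W = diag s \<bullet> mat 1"
  shows "W = mat 1"
proof -
  have pos: "0 < s$2 + s$3" "0 < s$1 + s$3" "0 < s$1 + s$2"
    using assms(1) by simp_all
  have "pairs_nonneg s"
    using assms(1) by (auto simp: pairs_nonneg_def less_imp_le)
  then have "1 + W$1$1 = W$2$2 + W$3$3 \<and> 1 + W$2$2 = W$1$1 + W$3$3 \<and> 1 + W$3$3 = W$1$1 + W$2$2"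
    using diag_inner_le(2)[of s W] assms(2,3) pos by simp
  then have "trace W = 3"
    by (simp add: trace_def sum_3)
  then show ?thesis
    by (rule SO3_trace_le_3(2)[OF assms(2)])
qed

section \<open>Invariance of the Haar measure\<close>

lemma haar_prob: "haar_SO3 \<mu> \<Longrightarrow> prob_space \<mu>"
  by (simp add: haar_SO3_def)

lemma haar_sets: "haar_SO3 \<mu> \<Longrightarrow> sets \<mu> = sets (restrict_space borel SO3)"
  by (simp add: haar_SO3_def)

lemma haar_space: "haar_SO3 \<mu> \<Longrightarrow> space \<mu> = SO3"
  using sets_eq_imp_space_eq[OF haar_sets] by (simp add: space_restrict_space)

lemma haar_measurable_borel:
  assumes "haar_SO3 \<mu>" "f \<in> borel_measurable borel"
  shows "f \<in> borel_measurable \<mu>"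
  using measurable_restrict_space1[OF assms(2)] measurable_cong_sets[OF haar_sets[OF assms(1)] refl] by blast

lemma haar_measurable_into:
  assumes "haar_SO3 \<mu>" "f \<in> borel_measurable M" "\<And>x. x \<in> space M \<Longrightarrow> f x \<in> SO3"
  shows "f \<in> measurable M \<mu>"
  using measurable_restrict_space2[of f M SO3 borel] assms
    measurable_cong_sets[OF refl haar_sets[OF assms(1)]] by blast

lemma haar_id_borel: "haar_SO3 \<mu> \<Longrightarrow> (\<lambda>Q. Q) \<in> borel_measurable \<mu>"
  by (rule haar_measurable_borel) auto

lemma continuous_matrix_mult:
  fixes f g :: "'a::topological_space \<Rightarrow> real^'n^'n"
  assumes "continuous_on S f" "continuous_on S g"
  shows "continuous_on S (\<lambda>x. f x ** g x)"
  unfolding matrix_matrix_mult_def using assms by (intro continuous_intros)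

lemma continuous_transpose: "continuous_on S (transpose :: real^'n^'n \<Rightarrow> _)"
  unfolding transpose_def by (intro continuous_intros)

lemma haar_measurable_mult:
  assumes h: "haar_SO3 \<mu>" and fg: "f \<in> measurable M \<mu>" "g \<in> measurable M \<mu>"
  shows "(\<lambda>x. f x ** g x) \<in> measurable M \<mu>"
proof (rule haar_measurable_into[OF h])
  have "f \<in> borel_measurable M" "g \<in> borel_measurable M"
    using measurable_compose[OF _ haar_id_borel[OF h]] fg by auto
  then show "(\<lambda>x. f x ** g x) \<in> borel_measurable M"
    by (rule borel_measurable_continuous_Pair)
       (intro continuous_matrix_mult continuous_intros)
  show "f x ** g x \<in> SO3" if "x \<in> space M" for x
    using measurable_space[OF fg(1) that] measurable_space[OF fg(2) that] SO3_mult haar_space[OF h] by auto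
qed

lemma haar_measurable_transpose:
  assumes h: "haar_SO3 \<mu>" and f: "f \<in> measurable M \<mu>"
  shows "(\<lambda>x. transpose (f x)) \<in> measurable M \<mu>"
proof (rule haar_measurable_into[OF h])
  have "f \<in> borel_measurable M"
    using measurable_compose[OF f haar_id_borel[OF h]] by simp
  then show "(\<lambda>x. transpose (f x)) \<in> borel_measurable M"
    by (rule borel_measurable_continuous_on[OF continuous_transpose])
  show "transpose (f x) \<in> SO3" if "x \<in> space M" for x
    using measurable_space[OF f that] SO3_transpose haar_space[OF h] by auto
qed

lemma haar_measurable_const: "haar_SO3 \<mu> \<Longrightarrow> Q \<in> SO3 \<Longrightarrow> (\<lambda>x. Q) \<in> measurable M \<mu>"
  by (simp add: haar_space)

lemma haar_left_invariant: "haar_SO3 \<mu> \<Longrightarrow> Q \<in> SO3 \<Longrightarrow> distr \<mu> \<mu> (\<lambda>R. Q ** R) = \<mu>"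
  by (simp add: haar_SO3_def)

text \<open>A left invariant probability measure on a group is invariant under inversion, by evaluating the double
integral of \<open>f (x\<^sup>T y)\<close> in both orders. Integrating over \<open>y\<close> first removes \<open>x\<^sup>T\<close>; integrating over \<open>x\<close> first,
where \<open>x\<^sup>T y = (y\<^sup>T x)\<^sup>T\<close>, removes \<open>y\<^sup>T\<close> and leaves the transpose.\<close>

lemma haar_transpose_invariant:
  assumes h: "haar_SO3 \<mu>"
  shows "distr \<mu> \<mu> transpose = \<mu>"
proof (rule measure_eqI)
  interpret prob_space \<mu> by (rule haar_prob[OF h])
  interpret P: pair_sigma_finite \<mu> \<mu> by unfold_locales
  have tm: "transpose \<in> measurable \<mu> \<mu>"
    using haar_measurable_transpose[OF h measurable_ident] by simp
  have lm: "(\<lambda>y. x ** y) \<in> measurable \<mu> \<mu>" if "x \<in> SO3" for x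
    using haar_measurable_mult[OF h haar_measurable_const[OF h that] measurable_ident] by simp
  have left: "(\<integral>\<^sup>+y. f (x ** y) \<partial>\<mu>) = (\<integral>\<^sup>+y. f y \<partial>\<mu>)"
    if "x \<in> SO3" "f \<in> borel_measurable \<mu>" for f :: "_ \<Rightarrow> ennreal" and x
    using nn_integral_distr[OF lm[OF that(1)], of f] that haar_left_invariant[OF h that(1)] by simp
  have tr: "transpose x \<in> SO3" if "x \<in> space \<mu>" for x
    using that SO3_transpose haar_space[OF h] by simp
  fix A assume A: "A \<in> sets (distr \<mu> \<mu> transpose)"
  define f :: "real^3^3 \<Rightarrow> ennreal" where "f = indicator A"
  have f: "f \<in> borel_measurable \<mu>" using A by (simp add: f_def)
  have ft: "(\<lambda>z. f (transpose z)) \<in> borel_measurable \<mu>"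
    using measurable_compose[OF tm f] .
  have m: "(\<lambda>(x, y). f (transpose x ** y)) \<in> borel_measurable (\<mu> \<Otimes>\<^sub>M \<mu>)"
    unfolding case_prod_beta
    by (intro measurable_compose[OF _ f] haar_measurable_mult[OF h] haar_measurable_transpose[OF h]
        measurable_fst measurable_snd)
  have prob: "(\<integral>\<^sup>+x. c \<partial>\<mu>) = c" for c :: ennreal
    by (simp add: emeasure_space_1)
  have "(\<integral>\<^sup>+y. f y \<partial>\<mu>) = (\<integral>\<^sup>+x. (\<integral>\<^sup>+y. f y \<partial>\<mu>) \<partial>\<mu>)"
    by (rule prob[symmetric])
  also have "\<dots> = (\<integral>\<^sup>+x. (\<integral>\<^sup>+y. f (transpose x ** y) \<partial>\<mu>) \<partial>\<mu>)"
    by (rule nn_integral_cong) (simp add: left[OF tr f])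
  also have "\<dots> = (\<integral>\<^sup>+y. (\<integral>\<^sup>+x. f (transpose x ** y) \<partial>\<mu>) \<partial>\<mu>)"
    by (rule P.Fubini'[OF m, symmetric])
  also have "\<dots> = (\<integral>\<^sup>+y. (\<integral>\<^sup>+x. f (transpose (transpose y ** x)) \<partial>\<mu>) \<partial>\<mu>)"
    by (simp add: matrix_transpose_mul)
  also have "\<dots> = (\<integral>\<^sup>+y. (\<integral>\<^sup>+x. f (transpose x) \<partial>\<mu>) \<partial>\<mu>)"
    by (rule nn_integral_cong) (simp add: left[OF tr ft])
  also have "\<dots> = (\<integral>\<^sup>+x. f (transpose x) \<partial>\<mu>)"
    by (rule prob)
  also have "\<dots> = (\<integral>\<^sup>+x. f x \<partial>distr \<mu> \<mu> transpose)"
    using nn_integral_distr[OF tm, of f] f by simp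
  finally show "emeasure (distr \<mu> \<mu> transpose) A = emeasure \<mu> A"
    using A by (simp add: f_def)
qed simp

text \<open>Multiplication by \<open>B\<close> from the right is left multiplication by \<open>B\<^sup>T\<close> between two transpositions.\<close>

lemma haar_biinvariant:
  assumes h: "haar_SO3 \<mu>" and "A \<in> SO3" "B \<in> SO3"
  shows "distr \<mu> \<mu> (\<lambda>Q. A ** Q ** B) = \<mu>"
proof -
  have tm: "transpose \<in> measurable \<mu> \<mu>"
    using haar_measurable_transpose[OF h measurable_ident] by simp
  have lm: "(\<lambda>y. x ** y) \<in> measurable \<mu> \<mu>" if "x \<in> SO3" for x
    using haar_measurable_mult[OF h haar_measurable_const[OF h that] measurable_ident] by simp
  have B': "transpose B \<in> SO3" by (rule SO3_transpose[OF assms(3)])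
  have comp: "distr \<mu> \<mu> (g \<circ> f) = \<mu>"
    if "distr \<mu> \<mu> f = \<mu>" "distr \<mu> \<mu> g = \<mu>" "f \<in> measurable \<mu> \<mu>" "g \<in> measurable \<mu> \<mu>" for f g
    using distr_distr[OF that(4,3)] that(1,2) by simp
  have "distr \<mu> \<mu> ((\<lambda>y. A ** y) \<circ> (transpose \<circ> ((\<lambda>y. transpose B ** y) \<circ> transpose))) = \<mu>"
    by (intro comp measurable_comp[where N = \<mu>] tm lm B' assms(2) haar_transpose_invariant[OF h] haar_left_invariant[OF h])
  then show ?thesis
    by (simp add: o_def matrix_transpose_mul matrix_mul_assoc)
qed

lemma haar_measurable_biinvariant:
  assumes h: "haar_SO3 \<mu>" and "A \<in> SO3" "B \<in> SO3"
  shows "(\<lambda>Q. A ** Q ** B) \<in> measurable \<mu> \<mu>"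
  using haar_measurable_mult[OF h haar_measurable_mult[OF h haar_measurable_const[OF h assms(2)] measurable_ident]
      haar_measurable_const[OF h assms(3)]] by simp

lemma haar_integral_biinvariant:
  fixes f :: "real^3^3 \<Rightarrow> real"
  assumes "haar_SO3 \<mu>" "A \<in> SO3" "B \<in> SO3" "f \<in> borel_measurable borel"
  shows "(LINT Q|\<mu>. f (A ** Q ** B)) = (LINT Q|\<mu>. f Q)"
  using integral_distr[OF haar_measurable_biinvariant[OF assms(1-3)] haar_measurable_borel[OF assms(1,4)]]
    haar_biinvariant[OF assms(1-3)] by simp

lemma haar_AE_left:
  assumes "haar_SO3 \<mu>" "A \<in> SO3" "AE Q in \<mu>. P Q"
  shows "AE Q in \<mu>. P (A ** Q)"
proof -
  have "AE Q in distr \<mu> \<mu> (\<lambda>Q. A ** Q ** mat 1). P Q"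
    using assms(3) by (simp only: haar_biinvariant[OF assms(1,2) SO3_mat_1])
  from AE_distrD[OF haar_measurable_biinvariant[OF assms(1,2) SO3_mat_1] this]
  show ?thesis by simp
qed

lemma haar_integrable_continuous:
  fixes f :: "real^3^3 \<Rightarrow> real"
  assumes h: "haar_SO3 \<mu>" and f: "continuous_on UNIV f"
  shows "integrable \<mu> f"
proof -
  interpret prob_space \<mu> by (rule haar_prob[OF h])
  have sub: "SO3 \<subseteq> cball 0 (sqrt 3)"
    using SO3_inner_self by (auto simp: norm_eq_sqrt_inner)
  have "bounded (f ` cball 0 (sqrt 3))"
    by (intro compact_imp_bounded compact_continuous_image continuous_on_subset[OF f]) auto
  then obtain B where "\<And>x. x \<in> SO3 \<Longrightarrow> norm (f x) \<le> B"
    using sub unfolding bounded_iff by blast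
  then show ?thesis
    using haar_measurable_borel[OF h borel_measurable_continuous_onI[OF f]] haar_space[OF h]
    by (intro integrable_const_bound[of _ B] AE_I2) auto
qed

text \<open>If \<open>Q\<^sub>i\<^sub>i + Q\<^sub>j\<^sub>j\<close> vanished almost everywhere, then so would \<open>Q\<^sub>i\<^sub>i - Q\<^sub>j\<^sub>j\<close> (half turn about axis \<open>i\<close>), hence
\<open>Q\<^sub>i\<^sub>i\<close>, hence every \<open>Q\<^sub>k\<^sub>i\<close> (quarter turn taking row \<open>k\<close> to row \<open>i\<close>): a zero column in a rotation.\<close>

lemma haar_AE_diagonal_pair:
  assumes h: "haar_SO3 \<mu>" and "i \<noteq> j"
  shows "\<not> (AE Q in \<mu>. Q $ i $ i + Q $ j $ j = 0)"
proof
  interpret prob_space \<mu> by (rule haar_prob[OF h])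
  assume *: "AE Q in \<mu>. Q $ i $ i + Q $ j $ j = 0"
  from haar_AE_left[OF h half_turn_SO3 this, of i]
  have "AE Q in \<mu>. Q $ i $ i - Q $ j $ j = 0"
    using \<open>i \<noteq> j\<close> by (simp add: half_turn_mult)
  with * have ii: "AE Q in \<mu>. Q $ i $ i = 0"
    by eventually_elim simp
  have "AE Q in \<mu>. Q $ k $ i = 0" for k
  proof (cases "k = i")
    case False
    then show ?thesis
      using haar_AE_left[OF h quarter_turn_SO3 ii, of i k] by (simp add: quarter_turn_mult_row)
  qed (use ii in simp)
  then have "AE Q in \<mu>. \<forall>k. Q $ k $ i = 0"
    by (simp add: AE_all_countable)
  then have "AE Q in \<mu>. False"
  proof (rule AE_mp, intro AE_I2 impI)
    fix Q assume "Q \<in> space \<mu>" and z: "\<forall>k. Q $ k $ i = 0"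
    then have "(transpose Q ** Q) $ i $ i = 1"
      using SO3_transpose_mult[of Q] haar_space[OF h] by (simp add: mat_def)
    then show False
      using z by (simp add: matrix_matrix_mult_def transpose_def)
  qed
  then show False by simp
qed

section \<open>The first moment of the density with diagonal parameter\<close>

text \<open>The normalizing constant is omitted, since a positive factor does not affect maximizers.\<close>

definition moment :: "(real^3^3) measure \<Rightarrow> real^3 \<Rightarrow> real^3" where
  "moment \<mu> s = (\<chi> i. LINT Q|\<mu>. Q $ i $ i * exp (diag s \<bullet> Q))"

lemma off_diagonal_moment:
  assumes h: "haar_SO3 \<mu>" and "i \<noteq> j"
  shows "(LINT Q|\<mu>. Q $ i $ j * exp (diag s \<bullet> Q)) = 0"
proof -
  let ?P = "half_turn i"
  let ?f = "\<lambda>Q. Q $ i $ j * exp (diag s \<bullet> Q)"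
  have "?f (?P ** Q ** ?P) = - ?f Q" for Q
    using \<open>i \<noteq> j\<close> by (simp add: diag_inner mult_half_turn half_turn_mult sum_3)
  moreover have "?f \<in> borel_measurable borel"
    by (intro borel_measurable_continuous_onI continuous_intros)
  ultimately show ?thesis
    using haar_integral_biinvariant[OF h half_turn_SO3[of i] half_turn_SO3[of i], of ?f] by simp
qed

lemma integral_inner_diag:
  assumes h: "haar_SO3 \<mu>"
  shows "(LINT Q|\<mu>. (W \<bullet> Q) * exp (diag s \<bullet> Q)) = diag (moment \<mu> s) \<bullet> W"
proof -
  have int: "integrable \<mu> (\<lambda>Q. Q $ i $ j * exp (diag s \<bullet> Q))" for i j
    by (intro haar_integrable_continuous[OF h] continuous_intros)
  have "(LINT Q|\<mu>. (W \<bullet> Q) * exp (diag s \<bullet> Q))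
      = (LINT Q|\<mu>. (\<Sum>i\<in>UNIV. \<Sum>j\<in>UNIV. W $ i $ j * (Q $ i $ j * exp (diag s \<bullet> Q))))"
    by (simp add: inner_matrix sum_distrib_right mult.assoc)
  also have "\<dots> = (\<Sum>i\<in>UNIV. \<Sum>j\<in>UNIV. W $ i $ j * (LINT Q|\<mu>. Q $ i $ j * exp (diag s \<bullet> Q)))"
    using int by simp
  also have "\<dots> = diag (moment \<mu> s) \<bullet> W"
    using off_diagonal_moment[OF h] by (simp add: diag_inner moment_def sum_3)
  finally show ?thesis .
qed

text \<open>Proved by folding the integral along the symmetry \<open>Q \<mapsto> A Q A\<close> for a quarter turn \<open>A\<close>, which makes the
integrand nonnegative.\<close>

lemma moment_pair:
  assumes h: "haar_SO3 \<mu>" and "i \<noteq> j" and nn: "0 \<le> s $ i + s $ j"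
  shows "0 \<le> moment \<mu> s $ i + moment \<mu> s $ j"
    and "moment \<mu> s $ i + moment \<mu> s $ j = 0 \<longleftrightarrow> s $ i + s $ j = 0"
proof -
  let ?A = "quarter_turn i j"
  \<comment> \<open>\<open>diag s \<bullet> Q = p * a Q + r Q\<close>, where \<open>a\<close> is odd and \<open>r\<close> is even under the symmetry\<close>
  define p where "p = (s $ i + s $ j) / 2"
  define a where "a Q = Q $ i $ i + Q $ j $ j" for Q :: "real^3^3"
  define r where "r Q = diag s \<bullet> Q - p * a Q" for Q
  define g where "g Q = a Q * (exp (p * a Q) - exp (- (p * a Q))) * exp (r Q)" for Q
  let ?f = "\<lambda>Q. a Q * exp (diag s \<bullet> Q)"
  have c: "continuous_on UNIV a" "continuous_on UNIV r" "continuous_on UNIV ?f" "continuous_on UNIV g"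
    unfolding g_def r_def a_def by (intro continuous_intros)+
  obtain k where k: "k \<noteq> i" "k \<noteq> j" "(UNIV :: 3 set) = {i, j, k}"
  proof -
    have "\<exists>k\<in>{1, 2, 3}. k \<noteq> i \<and> k \<noteq> j \<and> (\<forall>x. x = i \<or> x = j \<or> x = k)"
      using exhaust_3[of i] exhaust_3[of j] \<open>i \<noteq> j\<close> by (elim disjE) (simp_all add: forall_3)
    then show thesis
      using that by blast
  qed
  have sk: "diag s \<bullet> Q = s $ i * Q $ i $ i + s $ j * Q $ j $ j + s $ k * Q $ k $ k" for Q
    unfolding diag_inner k(3) using k(1,2) \<open>i \<noteq> j\<close> by simp
  have aA: "a (?A ** Q ** ?A) = - a Q" for Q
    using \<open>i \<noteq> j\<close> by (simp add: a_def quarter_turn_conj_diagonal)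
  have rA: "r (?A ** Q ** ?A) = r Q" for Q
    using \<open>i \<noteq> j\<close> k by (simp add: r_def sk aA quarter_turn_conj_diagonal)
        (simp add: a_def p_def field_simps)
  have sr: "diag s \<bullet> Q = p * a Q + r Q" for Q
    by (simp add: r_def)
  have g: "g Q = ?f Q + ?f (?A ** Q ** ?A)" for Q
    by (simp add: g_def sr aA rA exp_add exp_diff exp_minus field_simps)
  have sum: "moment \<mu> s $ i + moment \<mu> s $ j = (LINT Q|\<mu>. ?f Q)"
    unfolding moment_def vec_lambda_beta a_def distrib_right
    by (intro Bochner_Integration.integral_add[symmetric] haar_integrable_continuous[OF h] continuous_intros)
  have fold: "(LINT Q|\<mu>. g Q) = (LINT Q|\<mu>. ?f Q) + (LINT Q|\<mu>. ?f (?A ** Q ** ?A))"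
    unfolding g
    by (intro Bochner_Integration.integral_add haar_integrable_continuous[OF h] c
        continuous_on_compose2[OF c(3)] continuous_matrix_mult continuous_intros) auto
  have inv: "(LINT Q|\<mu>. ?f (?A ** Q ** ?A)) = (LINT Q|\<mu>. ?f Q)"
    using quarter_turn_SO3[OF \<open>i \<noteq> j\<close>]
    by (intro haar_integral_biinvariant[OF h] borel_measurable_continuous_onI c) auto
  have eq: "2 * (moment \<mu> s $ i + moment \<mu> s $ j) = (LINT Q|\<mu>. g Q)"
    unfolding sum fold inv by (rule mult_2)
  have p: "0 \<le> p" using nn by (simp add: p_def)
  have g0: "0 \<le> g Q" for Q
  proof (cases "0 \<le> a Q")
    case True
    then have "- (p * a Q) \<le> p * a Q" using p by simp
    then show ?thesis using True by (simp add: g_def)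
  next
    case False
    then have "p * a Q \<le> - (p * a Q)" using p by (simp add: mult_nonneg_nonpos)
    then show ?thesis using False by (simp add: g_def mult_nonpos_nonpos)
  qed
  have "0 \<le> (LINT Q|\<mu>. g Q)"
    by (simp add: g0)
  then show "0 \<le> moment \<mu> s $ i + moment \<mu> s $ j"
    by (simp flip: eq)
  show "moment \<mu> s $ i + moment \<mu> s $ j = 0 \<longleftrightarrow> s $ i + s $ j = 0"
  proof
    assume "s $ i + s $ j = 0"
    then have "p = 0" by (simp add: p_def)
    then show "moment \<mu> s $ i + moment \<mu> s $ j = 0" using eq by (simp add: g_def)
  next
    assume "moment \<mu> s $ i + moment \<mu> s $ j = 0"
    then have "AE Q in \<mu>. g Q = 0"
      using integral_nonneg_eq_0_iff_AE[OF haar_integrable_continuous[OF h c(4)]] g0 eq by simp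
    then have "AE Q in \<mu>. a Q = 0" if "p \<noteq> 0"
      by (rule AE_mp) (use that in \<open>auto simp: g_def intro!: AE_I2\<close>)
    then have "p = 0"
      using haar_AE_diagonal_pair[OF h \<open>i \<noteq> j\<close>] unfolding a_def[symmetric] by blast
    then show "s $ i + s $ j = 0" by (simp add: p_def)
  qed
qed

lemma moment_same_maximizers:
  assumes h: "haar_SO3 \<mu>" and s: "pairs_nonneg s"
  shows "pairs_nonneg (moment \<mu> s)"
    and "W \<in> SO3 \<Longrightarrow> diag (moment \<mu> s) \<bullet> W = diag (moment \<mu> s) \<bullet> mat 1 \<longleftrightarrow> diag s \<bullet> W = diag s \<bullet> mat 1"
proof -
  show *: "pairs_nonneg (moment \<mu> s)"
    using moment_pair(1)[OF h] s by (simp add: pairs_nonneg_def)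
  have "moment \<mu> s $ i + moment \<mu> s $ j = 0 \<longleftrightarrow> s $ i + s $ j = 0" if "i \<noteq> j" for i j
    using moment_pair(2)[OF h that] s that by (simp add: pairs_nonneg_def)
  then show "diag (moment \<mu> s) \<bullet> W = diag (moment \<mu> s) \<bullet> mat 1 \<longleftrightarrow> diag s \<bullet> W = diag s \<bullet> mat 1" if "W \<in> SO3"
    by (simp add: diag_inner_le(2)[OF s that] diag_inner_le(2)[OF * that])
qed

section \<open>The two means of the matrix Fisher distribution\<close>

text \<open>The sign corrections that make \<open>U\<close> and \<open>V\<close> rotations are absorbed by the sign of the third entry of \<open>S\<close>,
so \<open>F\<close> is unchanged; as that entry keeps its modulus, \<open>s\<^sub>2 + s\<^sub>3\<close> stays nonnegative.\<close>

lemma is_proper_svdE: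
  assumes "is_proper_svd F U S V"
  obtains s where "U \<in> SO3" "V \<in> SO3" "S = diag s" "F = U ** diag s ** transpose V"
    "s $ 3 \<le> s $ 2" "s $ 2 \<le> s $ 1" "0 \<le> s $ 2 + s $ 3"
proof -
  obtain U' s1 s2 s3 V' where svd: "is_svd F U' s1 s2 s3 V'"
    and U: "U = U' ** diag3 1 1 (det U')" and V: "V = V' ** diag3 1 1 (det V')"
    and S: "S = diag3 s1 s2 (det (U' ** V') * s3)"
    using assms unfolding is_proper_svd_def by blast
  have o: "orthogonal_matrix U'" "orthogonal_matrix V'"
    and le: "s2 \<le> s1" "s3 \<le> s2" "0 \<le> s3" and F: "F = U' ** diag3 s1 s2 s3 ** transpose V'"
    using svd by (auto simp: is_svd_def)
  have dets: "det U' = 1 \<or> det U' = - 1" "det V' = 1 \<or> det V' = - 1"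
    using o det_orthogonal_matrix by blast+
  have E: "transpose (diag3 1 1 d) = diag3 1 1 d" "diag3 1 1 d ** diag3 1 1 d = mat 1" "det (diag3 1 1 d) = d"
    if "d = 1 \<or> d = - 1" for d
    using that
    by (auto simp: diag3_def vec_eq_iff forall_3 matrix_matrix_mult_def sum_3 transpose_def mat_def det_3 vector_3)
  have SO: "X ** diag3 1 1 (det X) \<in> SO3" if "orthogonal_matrix X" "det X = 1 \<or> det X = - 1" for X
  proof -
    have "orthogonal_matrix (diag3 1 1 (det X))" "det (X ** diag3 1 1 (det X)) = 1"
      using E[OF that(2)] that(2) by (auto simp: orthogonal_matrix det_mul)
    then show ?thesis
      using orthogonal_matrix_mul that(1) by (simp add: SO3_def rotation_matrix_def)
  qed
  have mid: "diag3 1 1 (det U') ** S ** diag3 1 1 (det V') = diag3 s1 s2 s3"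
    using dets unfolding S det_mul
    by (auto simp: diag3_def vec_eq_iff forall_3 matrix_matrix_mult_def sum_3 vector_3)
  have "U ** S ** transpose V = U' ** (diag3 1 1 (det U') ** S ** diag3 1 1 (det V')) ** transpose V'"
    unfolding U V by (simp add: matrix_transpose_mul E dets matrix_mul_assoc)
  then have "F = U ** S ** transpose V"
    by (simp add: F mid)
  moreover have "\<bar>det (U' ** V') * s3\<bar> = s3"
    using dets le by (auto simp: det_mul)
  ultimately show thesis
    using that[of "vector [s1, s2, det (U' ** V') * s3]"] SO[OF o(1) dets(1)] SO[OF o(2) dets(2)] le
    by (auto simp: U V S diag3_eq_diag vector_3)
qed

lemma frobenius_norm_diff_SO3:
  assumes "R \<in> SO3" "Q \<in> SO3"
  shows "(frobenius_norm (R - Q))\<^sup>2 = 6 - 2 * (R \<bullet> Q)"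
  using SO3_inner_self[OF assms(1)] SO3_inner_self[OF assms(2)] inner_ge_zero[of "R - Q"]
  by (simp add: frobenius_norm_def trace_eq_inner inner_diff_left inner_diff_right inner_commute[of Q R])

text \<open>Once one optimizer is known, the set of optimizers is a level set; both means are computed in this way.\<close>

lemma is_arg_max_iff_attains:
  fixes f :: "'a \<Rightarrow> 'b::linorder"
  assumes "P m" "\<And>x. P x \<Longrightarrow> f x \<le> f m"
  shows "is_arg_max f P x \<longleftrightarrow> P x \<and> f x = f m"
  using assms unfolding is_arg_max_def by (metis order.strict_iff_not order.antisym linorder_not_le)

lemma is_arg_min_iff_attains:
  fixes f :: "'a \<Rightarrow> 'b::linorder"
  assumes "P m" "\<And>x. P x \<Longrightarrow> f m \<le> f x"
  shows "is_arg_min f P x \<longleftrightarrow> P x \<and> f x = f m"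
  using assms unfolding is_arg_min_def by (metis order.strict_iff_not order.antisym linorder_not_le)

lemma fisher_const_pos:
  assumes h: "haar_SO3 \<mu>"
  shows "0 < fisher_const \<mu> F"
proof -
  interpret prob_space \<mu> by (rule haar_prob[OF h])
  have int: "integrable \<mu> (\<lambda>Q. exp (F \<bullet> Q))"
    by (intro haar_integrable_continuous[OF h] continuous_intros)
  have "\<not> (AE Q in \<mu>. exp (F \<bullet> Q) = 0)"
    by simp
  then have "(LINT Q|\<mu>. exp (F \<bullet> Q)) \<noteq> 0"
    using integral_nonneg_eq_0_iff_AE[OF int] by simp
  moreover have "0 \<le> (LINT Q|\<mu>. exp (F \<bullet> Q))"
    by simp
  ultimately show ?thesis
    unfolding fisher_const_def trace_eq_inner by linarith
qed

lemma mean_square_error_fisher: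
  assumes h: "haar_SO3 \<mu>" and "R \<in> SO3"
  shows "(LINT Q|\<mu>. (frobenius_norm (R - Q))\<^sup>2 * fisher_density \<mu> F Q)
    = 6 - 2 / fisher_const \<mu> F * (LINT Q|\<mu>. (R \<bullet> Q) * exp (F \<bullet> Q))"
proof -
  let ?c = "fisher_const \<mu> F"
  have int: "integrable \<mu> (\<lambda>Q. exp (F \<bullet> Q))" "integrable \<mu> (\<lambda>Q. (R \<bullet> Q) * exp (F \<bullet> Q))"
    by (intro haar_integrable_continuous[OF h] continuous_intros)+
  have "(LINT Q|\<mu>. (frobenius_norm (R - Q))\<^sup>2 * fisher_density \<mu> F Q)
      = (LINT Q|\<mu>. 6 / ?c * exp (F \<bullet> Q) - 2 / ?c * ((R \<bullet> Q) * exp (F \<bullet> Q)))"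
    by (rule Bochner_Integration.integral_cong)
       (auto simp: haar_space[OF h] frobenius_norm_diff_SO3[OF assms(2)] fisher_density_def trace_eq_inner
         algebra_simps diff_divide_distrib)
  also have "\<dots> = 6 / ?c * (LINT Q|\<mu>. exp (F \<bullet> Q)) - 2 / ?c * (LINT Q|\<mu>. (R \<bullet> Q) * exp (F \<bullet> Q))"
    using int by simp
  also have "(LINT Q|\<mu>. exp (F \<bullet> Q)) = ?c"
    by (simp add: fisher_const_def trace_eq_inner)
  finally show ?thesis
    using fisher_const_pos[OF h, of F] by simp
qed

theorem mainTheorem3:
  fixes \<Omega> :: "'w measure" and \<mu> :: "(real^3^3) measure"
    and R :: "'w \<Rightarrow> real^3^3" and F U S V :: "real^3^3"
  assumes "haar_SO3 \<mu>"
    and "matrix_fisher \<Omega> \<mu> F R"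
    and "is_proper_svd F U S V"
  shows "U ** transpose V \<in> SO3 \<and>
    max_mean (fisher_density \<mu> F) = mmse_mean \<mu> (fisher_density \<mu> F) \<and>
    U ** transpose V \<in> max_mean (fisher_density \<mu> F) \<and>
    (S $ 2 $ 2 + S $ 3 $ 3 > 0 \<longrightarrow> max_mean (fisher_density \<mu> F) = {U ** transpose V})"
proof -
  note h = assms(1)
  obtain s where U: "U \<in> SO3" and V: "V \<in> SO3" and S: "S = diag s"
    and F: "F = U ** diag s ** transpose V"
    and le: "s $ 3 \<le> s $ 2" "s $ 2 \<le> s $ 1" "0 \<le> s $ 2 + s $ 3"
    using is_proper_svdE[OF assms(3)] by blast
  have s: "pairs_nonneg s"
    using le by (auto simp: pairs_nonneg_def forall_3)
  let ?c = "fisher_const \<mu> F" and ?m = "U ** transpose V"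
  have c: "0 < ?c" by (rule fisher_const_pos[OF h])
  define W where "W R = transpose U ** R ** V" for R
  have m: "?m \<in> SO3" using U V by (simp add: SO3_mult SO3_transpose)
  have W: "W R \<in> SO3" if "R \<in> SO3" for R
    using that U V by (simp add: W_def SO3_mult SO3_transpose)
  have Winv: "U ** W R ** transpose V = R" for R
  proof -
    have "U ** W R ** transpose V = (U ** transpose U) ** R ** (V ** transpose V)"
      by (simp add: W_def matrix_mul_assoc)
    then show ?thesis by (simp add: SO3_mult_transpose U V)
  qed
  have Wm: "W ?m = mat 1"
  proof -
    have "W ?m = (transpose U ** U) ** (transpose V ** V)"
      by (simp add: W_def matrix_mul_assoc)
    then show ?thesis by (simp add: SO3_transpose_mult U V)
  qed
  have inner_W: "X \<bullet> (U ** Q ** transpose V) = W X \<bullet> Q" for X Q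
    using inner_matrix_mult_left[of U "Q ** transpose V" X] inner_matrix_mult_right[of Q "transpose V" "transpose U ** X"]
    by (simp add: W_def matrix_mul_assoc inner_commute)
  have WF: "W F = diag s"
  proof -
    have "W F = (transpose U ** U) ** diag s ** (transpose V ** V)"
      by (simp add: W_def F matrix_mul_assoc)
    then show ?thesis by (simp add: SO3_transpose_mult U V)
  qed
  have FR: "F \<bullet> R = diag s \<bullet> W R" for R
    using inner_W[of F "W R"] by (simp add: Winv WF)
  have dens: "fisher_density \<mu> F R = exp (diag s \<bullet> W R) / ?c" for R
    by (simp add: fisher_density_def trace_eq_inner FR)
  have "(LINT Q|\<mu>. (R \<bullet> Q) * exp (F \<bullet> Q)) = diag (moment \<mu> s) \<bullet> W R" for R
  proof -
    have "(LINT Q|\<mu>. (R \<bullet> Q) * exp (F \<bullet> Q))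
        = (LINT Q|\<mu>. (R \<bullet> (U ** Q ** transpose V)) * exp (F \<bullet> (U ** Q ** transpose V)))"
      by (rule haar_integral_biinvariant[OF h U SO3_transpose[OF V], symmetric])
         (intro borel_measurable_continuous_onI continuous_intros)
    also have "\<dots> = diag (moment \<mu> s) \<bullet> W R"
      by (simp add: inner_W WF integral_inner_diag[OF h])
    finally show ?thesis .
  qed
  then have err: "(LINT Q|\<mu>. (frobenius_norm (R - Q))\<^sup>2 * fisher_density \<mu> F Q)
      = 6 - 2 / ?c * (diag (moment \<mu> s) \<bullet> W R)" if "R \<in> SO3" for R
    using mean_square_error_fisher[OF h that] by simp
  have max: "max_mean (fisher_density \<mu> F) = {R \<in> SO3. diag s \<bullet> W R = diag s \<bullet> mat 1}"
    unfolding max_mean_def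
    using is_arg_max_iff_attains[of "\<lambda>R. R \<in> SO3" ?m "fisher_density \<mu> F"] m W c diag_inner_le(1)[OF s]
    by (auto simp: dens Wm divide_le_cancel)
  have mmse: "mmse_mean \<mu> (fisher_density \<mu> F)
      = {R \<in> SO3. diag (moment \<mu> s) \<bullet> W R = diag (moment \<mu> s) \<bullet> mat 1}"
  proof -
    let ?e = "\<lambda>R. LINT Q|\<mu>. (frobenius_norm (R - Q))\<^sup>2 * fisher_density \<mu> F Q"
    have "?e ?m \<le> ?e R" if "R \<in> SO3" for R
      using diag_inner_le(1)[OF moment_same_maximizers(1)[OF h s] W[OF that]] c
      by (simp add: err that m Wm divide_right_mono)
    then have "is_arg_min ?e (\<lambda>R. R \<in> SO3) R \<longleftrightarrow> R \<in> SO3 \<and> ?e R = ?e ?m" for R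
      using is_arg_min_iff_attains[of "\<lambda>R. R \<in> SO3" ?m ?e] m by blast
    also have "R \<in> SO3 \<and> ?e R = ?e ?m \<longleftrightarrow>
        R \<in> SO3 \<and> diag (moment \<mu> s) \<bullet> W R = diag (moment \<mu> s) \<bullet> mat 1" for R
      using c m by (auto simp: err Wm)
    finally show ?thesis
      unfolding mmse_mean_def by blast
  qed
  have "max_mean (fisher_density \<mu> F) = mmse_mean \<mu> (fisher_density \<mu> F)"
    unfolding max mmse using moment_same_maximizers(2)[OF h s] W by blast
  moreover have "?m \<in> max_mean (fisher_density \<mu> F)"
    by (simp add: max m Wm)
  moreover have "max_mean (fisher_density \<mu> F) = {?m}" if "S $ 2 $ 2 + S $ 3 $ 3 > 0"
  proof -
    have pos: "0 < s $ i + s $ j" if "i \<noteq> j" for i j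
      using \<open>S $ 2 $ 2 + S $ 3 $ 3 > 0\<close> le that exhaust_3[of i] exhaust_3[of j]
      by (auto simp: S diag_def)
    have uniq: "R = ?m" if "R \<in> max_mean (fisher_density \<mu> F)" for R
      using diag_inner_max_unique[OF pos W, of R] that Winv[of R] by (simp add: max)
    show ?thesis
    proof (intro equalityI subsetI)
      show "R \<in> {?m}" if "R \<in> max_mean (fisher_density \<mu> F)" for R
        unfolding singleton_iff by (rule uniq[OF that])
      show "R \<in> max_mean (fisher_density \<mu> F)" if "R \<in> {?m}" for R
        using that by (simp add: max m Wm)
    qed
  qed
  ultimately show ?thesis
    using m by blast
qed

end
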